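(* Let $\mathcal{M}$ be a positroid of rank $d$ on $[n]$ without loops or coloops, and let $\pi$ be its associated (fixed-point-free) decorated permutation. Then the matroid polytope $\Gamma_{\mathcal{M}}\subset\mathbb{R}^n$ is exactly the set of points $x\in\mathbb{R}^n$ satisfying the inequalities $x_i\ge 0$ for all $i\in[n]$, the equality $x_1+\cdots+x_n=d$, and the inequalities $$\sum_{l\in E}x_l\le d-\operatorname{ccw}(E^c)$$ for all cyclic intervals $E\subseteq[n]$ whose complement $E^c=[n]\setminus E$ is covered by CCW-arrows of $\pi$.
   Context: A positroid of rank $d$ on $[n]=\{1,\dots,n\}$ is a matroid whose bases are the column sets of the nonzero maximal minors of some real $d\times n$ matrix of rank $d$ all of whose maximal minors are nonnegative. The cyclically shifted order $<_i$ on $[n]$ is $i<_i i+1<_i\cdots<_i n<_i 1<_i\cdots<_i i-1$. For $a,b\in[n]$ the cyclic interval is $[a,b]=\{x\in[n]: x\le_a b\}$ (nonempty; $[a,a-1]=[n]$, indices mod $n$). Decorated permutation of a loopless and coloopless positroid $\mathcal{M}$ with rank function $\operatorname{rk}$: it is the permutation $\pi$ of $[n]$ (without fixed points) for which $\pi(i)$ is the first element $j$ in the list $i+1,i+2,\dots,i-1$ (cyclically) such that $\operatorname{rk}(\{i,i+1,\dots,j\})=\operatorname{rk}(\{i+1,\dots,j\})$. A CCW-arrow of $\pi$ is a cyclic interval of the form $[x,\pi^{-1}(x)]$, one for each $x\in[n]$. For $S\subseteq[n]$, $\operatorname{ccw}(S)$ is the number of $x\in[n]$ with $[x,\pi^{-1}(x)]\subseteq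 S$. A set $S\subseteq[n]$ is covered by CCW-arrows of $\pi$ if each element of $S$ is contained in some CCW-arrow of $\pi$ that is itself contained in $S$ (vacuously true for $S=\emptyset$). The matroid polytope is $\Gamma_{\mathcal{M}}=\operatorname{conv}\{e_B : B \text{ a basis of }\mathcal{M}\}$ with $e_B=\sum_{i\in B}e_i$, where $e_1,\dots,e_n$ is the standard basis of $\mathbb{R}^n$. *)

theory Defs
  imports "HOL-Analysis.Analysis"
begin

text \<open>
  The ground set $[n]$ is a finite linearly ordered type, so that $n$ is its cardinality and
  $1 < \dots < n$ is its order.  A matroid on it is given by its set of bases.
\<close>

section \<open>Matroids given by their bases\<close>

definition indep :: "'n set set \<Rightarrow> 'n set \<Rightarrow> bool" where
  "indep M X \<longleftrightarrow> (\<exists>B\<in>M. X \<subseteq> B)"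

definition rk :: "'n::finite set set \<Rightarrow> 'n set \<Rightarrow> nat" where
  "rk M S = Max {card X | X. X \<subseteq> S \<and> indep M X}"

definition is_loop :: "'n set set \<Rightarrow> 'n \<Rightarrow> bool" where
  "is_loop M i \<longleftrightarrow> (\<forall>B\<in>M. i \<notin> B)"

definition is_coloop :: "'n set set \<Rightarrow> 'n \<Rightarrow> bool" where
  "is_coloop M i \<longleftrightarrow> (\<forall>B\<in>M. i \<in> B)"

definition matroid_polytope :: "'n::finite set set \<Rightarrow> (real ^ 'n) set" where
  "matroid_polytope M = convex hull ((\<lambda>B. \<Sum>i\<in>B. axis i 1) ` M)"

section \<open>Positroids\<close>

text \<open>
  The rows are indexed by a finite linearly ordered type of cardinality $d$.  A choice of $d$
  columns in increasing order is a strictly monotone map from row indices to column indices, and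
  its range is the column set.  The row order matters, since it determines the sign of the minor.
\<close>

definition max_minor ::
    "real ^ 'n::{finite,linorder} ^ 'd::{finite,linorder} \<Rightarrow> ('d \<Rightarrow> 'n) \<Rightarrow> real" where
  "max_minor A f = det (\<chi> i j. A $ i $ f j)"

text \<open>
  The type argument carries the rank $d$.  The matroid axioms need not be demanded, because the
  column sets of the nonzero maximal minors of a matrix of full row rank always satisfy them.
\<close>

definition positroid ::
    "'d::{finite,linorder} itself \<Rightarrow> 'n::{finite,linorder} set set \<Rightarrow> bool" where
  "positroid (_ :: 'd itself) M \<longleftrightarrow>
     (\<exists>A :: real ^ 'n::{finite,linorder} ^ 'd::{finite,linorder}.
        rank A = CARD('d) \<and>
        (\<forall>f. strict_mono f \<longrightarrow> max_minor A f \<ge> 0) \<and>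
        M = {range f | f. strict_mono f \<and> max_minor A f \<noteq> 0})"

section \<open>Cyclic intervals and the decorated permutation\<close>

text \<open>The shifted order lists the elements from \<open>a\<close> upwards first, then those below \<open>a\<close>.\<close>

definition cyc_le :: "'n::linorder \<Rightarrow> 'n \<Rightarrow> 'n \<Rightarrow> bool" where
  "cyc_le a x y \<longleftrightarrow> (if (a \<le> x) = (a \<le> y) then x \<le> y else a \<le> x)"

definition cyc_interval :: "'n::linorder \<Rightarrow> 'n \<Rightarrow> 'n set" where
  "cyc_interval a b = {x. cyc_le a x b}"

text \<open>
  For \<open>j \<noteq> i\<close> the set $\{i+1,\dots,j\}$ is \<open>cyc_interval i j - {i}\<close>.  The first such \<open>j\<close> exists
  whenever \<open>i\<close> is not a coloop.
\<close>

definition decorated_permutation ::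
    "'n::{finite,linorder} set set \<Rightarrow> 'n \<Rightarrow> 'n" where
  "decorated_permutation M i =
     (let P = (\<lambda>j. j \<noteq> i \<and> rk M (cyc_interval i j) = rk M (cyc_interval i j - {i}))
      in THE j. P j \<and> (\<forall>k. P k \<longrightarrow> cyc_le i j k))"

definition ccw_arrow :: "('n::linorder \<Rightarrow> 'n) \<Rightarrow> 'n \<Rightarrow> 'n set" where
  "ccw_arrow \<pi> x = cyc_interval x (inv \<pi> x)"

definition ccw :: "('n::linorder \<Rightarrow> 'n) \<Rightarrow> 'n set \<Rightarrow> nat" where
  "ccw \<pi> S = card {x. ccw_arrow \<pi> x \<subseteq> S}"

definition covered_by_ccw_arrows :: "('n::linorder \<Rightarrow> 'n) \<Rightarrow> 'n set \<Rightarrow> bool" where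
  "covered_by_ccw_arrows \<pi> S \<longleftrightarrow>
     (\<forall>s\<in>S. \<exists>x. s \<in> ccw_arrow \<pi> x \<and> ccw_arrow \<pi> x \<subseteq> S)"

end

theory Submission imports Defs begin

text \<open>
  The columns of the matrix represent the matroid, and counting the CCW-arrows inside \<open>- E\<close> is
  counting the rank steps from a cyclic interval \<open>E\<close> to the whole set, so the stated inequalities
  are $x(E) \le \mathrm{rk}(E)$. The covering hypothesis costs nothing: at an
  uncovered point the complement splits into two shorter intervals with the same arrows.

  It remains to derive $x(A) \le \mathrm{rk}(A)$ for every \<open>A\<close> from the cyclic intervals. Take a
  minimal violator \<open>A\<close>; minimality makes the exchange graph of $M|A$ connected. If \<open>a\<close> can be
  exchanged for \<open>a'\<close> in a basis of \<open>A\<close>, nonnegativity of the minors fixes the parity of the number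
  of elements between \<open>a\<close> and \<open>a'\<close> in a basis \<open>R\<close> of $M/A$, independently of \<open>R\<close>. Hence exchanges
  in $M/A$ stay inside one gap of \<open>A\<close>, that is, $M/A$ is a direct sum over the cyclic gaps
  \<open>g\<close> of \<open>A\<close>. The complements of the gaps are cyclic intervals of rank $d - |R \cap g|$, and adding up
  their inequalities gives the inequality for \<open>A\<close>.
\<close>

section \<open>Cyclic intervals\<close>

lemma cyc_le_refl: "cyc_le a x x" by (simp add: cyc_le_def)

lemma cyc_le_first: "cyc_le a a x" by (auto simp: cyc_le_def)

lemma cyc_le_total: "cyc_le a x y \<or> cyc_le a y x"
  by (auto simp: cyc_le_def split: if_splits)

lemma cyc_le_antisym: "cyc_le a x y \<Longrightarrow> cyc_le a y x \<Longrightarrow> x = y"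
  by (auto simp: cyc_le_def split: if_splits)

lemma cyc_le_trans: "cyc_le a x y \<Longrightarrow> cyc_le a y z \<Longrightarrow> cyc_le a x z"
  by (smt (verit) cyc_le_def order_trans linear)

text \<open>With the end \<open>b\<close> fixed, \<open>cyc_le x y b\<close> orders start points:
  \<open>y\<close> lies on the way from \<open>x\<close> to \<open>b\<close>. This order serves to
  lengthen an interval backwards.\<close>

lemma cyc_le_start_total: "cyc_le x y b \<or> cyc_le y x b"
  by (auto simp: cyc_le_def split: if_splits)

lemma cyc_le_start_antisym: "cyc_le x y b \<Longrightarrow> cyc_le y x b \<Longrightarrow> x = y"
  by (auto simp: cyc_le_def split: if_splits)

lemma cyc_le_start_trans: "cyc_le x y b \<Longrightarrow> cyc_le y z b \<Longrightarrow> cyc_le x z b"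
  by (smt (verit) cyc_le_def order_trans linear)

lemma total_order_min:
  assumes "finite S" "S \<noteq> {}"
    and total: "\<And>x y. le x y \<or> le y x" and trans: "\<And>x y z. le x y \<Longrightarrow> le y z \<Longrightarrow> le x z"
  shows "\<exists>m\<in>S. \<forall>k\<in>S. le m k"
  using assms(1,2)
proof (induction rule: finite_ne_induct)
  case (singleton x) then show ?case using total by blast
next
  case (insert x F)
  then show ?case using total trans by (metis insert_iff)
qed

text \<open>From \<open>i\<close> outside $[a,b]$, the forward walk to \<open>b\<close> passes
  through all of $[a,b]$. So the arrow $[x,i]$ misses $[a,b]$ iff \<open>x\<close> comes strictly
  after \<open>b\<close> on that walk.\<close>

lemma arrow_avoids_interval_iff:
  assumes "x \<noteq> i"
  shows "cyc_interval x i \<subseteq> - cyc_interval a b \<longleftrightarrow> i \<notin> cyc_interval a b \<and> \<not> cyc_le i x b"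
proof -
  have 1: "cyc_le i x b \<Longrightarrow> b \<in> cyc_interval x i"
    using assms by (auto simp: cyc_le_def cyc_interval_def split: if_splits)
  have 2: "i \<in> cyc_interval x i" "b \<in> cyc_interval a b"
    by (auto simp: cyc_interval_def cyc_le_refl)
  show ?thesis
  proof
    assume "cyc_interval x i \<subseteq> - cyc_interval a b"
    then show "i \<notin> cyc_interval a b \<and> \<not> cyc_le i x b" using 1 2 by blast
  next
    assume h: "i \<notin> cyc_interval a b \<and> \<not> cyc_le i x b"
    show "cyc_interval x i \<subseteq> - cyc_interval a b"
    proof
      fix y assume y: "y \<in> cyc_interval x i"
      show "y \<in> - cyc_interval a b"
        using y h assms
        by (smt (verit) cyc_interval_def mem_Collect_eq Compl_iff cyc_le_def linear not_le order_trans)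
    qed
  qed
qed

text \<open>If \<open>s\<close> is outside $[a,b]$, deleting it cuts the complement into two
  stretches, the complements of $[s,b]$ and of $[a,s]$. An arrow cannot pass from one to the other
  without meeting \<open>s\<close> or $[a,b]$.\<close>

lemma arrow_avoiding_point:
  assumes "cyc_interval y i \<subseteq> - cyc_interval a b" "s \<notin> cyc_interval y i"
  shows "cyc_interval y i \<subseteq> - cyc_interval s b \<or> cyc_interval y i \<subseteq> - cyc_interval a s"
proof (rule ccontr)
  assume "\<not> ?thesis"
  then obtain p q where pq: "cyc_le y p i" "cyc_le s p b" "cyc_le y q i" "cyc_le a q s"
    by (auto simp: cyc_interval_def)
  have "\<not> cyc_le y a i" "\<not> cyc_le y b i" "\<not> cyc_le y s i" "\<not> cyc_le a p b" "\<not> cyc_le a q b"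
    using assms pq by (auto simp: cyc_interval_def cyc_le_refl cyc_le_first subset_iff)
  with pq show False
    unfolding cyc_le_def by (smt (verit) linear not_le order_trans)
qed

lemma cyc_interval_split:
  assumes "s \<notin> cyc_interval a b"
  shows "cyc_interval s b \<union> cyc_interval a s = UNIV"
    "cyc_interval s b \<inter> cyc_interval a s = insert s (cyc_interval a b)"
  using assms by (auto simp: cyc_interval_def cyc_le_def split: if_splits)

section \<open>Linear matroids and their base polytopes\<close>

text \<open>Injectivity makes two labels of one vector dependent; the image set alone would merge
  them.\<close>

definition lin_indep :: "('n::finite \<Rightarrow> 'v::euclidean_space) \<Rightarrow> 'n set \<Rightarrow> bool" where
  "lin_indep v X \<longleftrightarrow> inj_on v X \<and> independent (v ` X)"

lemma lin_indep_empty: "lin_indep v {}"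
  by (simp add: lin_indep_def independent_empty)

lemma lin_indep_subset: "lin_indep v X \<Longrightarrow> Y \<subseteq> X \<Longrightarrow> lin_indep v Y"
  unfolding lin_indep_def by (meson image_mono independent_mono inj_on_subset)

lemma lin_indep_insert: "lin_indep v X \<Longrightarrow> v e \<notin> span (v ` X) \<Longrightarrow> lin_indep v (insert e X)"
  unfolding lin_indep_def by (auto simp: independent_insert intro: span_base)

lemma lin_indep_insertD: "lin_indep v (insert e X) \<Longrightarrow> e \<notin> X \<Longrightarrow> v e \<notin> span (v ` X)"
  unfolding lin_indep_def by (auto simp: independent_insert split: if_splits)

lemma card_lin_indep: "lin_indep v X \<Longrightarrow> card X = dim (v ` X)"
  unfolding lin_indep_def by (simp add: dim_eq_card_independent card_image)

lemma lin_indep_extend: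
  assumes "lin_indep v X" "X \<subseteq> S"
  obtains Y where "X \<subseteq> Y" "Y \<subseteq> S" "lin_indep v Y" "span (v ` Y) = span (v ` S)"
proof -
  define F where "F = {Y. X \<subseteq> Y \<and> Y \<subseteq> S \<and> lin_indep v Y}"
  have "finite F" "X \<in> F" using assms by (auto simp: F_def)
  then obtain Y where Y: "Y \<in> F" and max: "\<And>Z. Z \<in> F \<Longrightarrow> Y \<subseteq> Z \<Longrightarrow> Z = Y"
    using finite_has_maximal2[of F X] by metis
  have "v s \<in> span (v ` Y)" if "s \<in> S" for s
  proof (rule ccontr)
    assume n: "v s \<notin> span (v ` Y)"
    have "insert s Y \<in> F" using Y that lin_indep_insert[OF _ n] by (auto simp: F_def)
    then have "insert s Y = Y" using max by blast
    then show False using n by (metis insertI1 image_eqI span_base)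
  qed
  then have "span (v ` Y) = span (v ` S)"
    using Y unfolding span_eq F_def by (blast intro: span_base)
  with Y that show thesis by (auto simp: F_def)
qed

text \<open>The independent set \<open>insert e (Y \<inter> W)\<close> grows to a basis
  \<open>Z\<close> inside \<open>insert e Y\<close>. It has the size of \<open>Y\<close>, so exactly
  one element is left out, and that one lies outside \<open>W\<close> because
  \<open>Y \<inter> W\<close> was kept.\<close>

lemma lin_indep_exchange:
  assumes Y: "lin_indep v Y" and e: "v e \<in> span (v ` Y)" "v e \<notin> span (v ` (Y \<inter> W))" "e \<in> W"
  obtains t where "t \<in> Y - W" "e \<notin> Y" "lin_indep v (insert e (Y - {t}))"
    "span (v ` insert e (Y - {t})) = span (v ` Y)"
proof -
  have eY: "e \<notin> Y" using e(2,3) by (auto intro: span_base)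
  have "lin_indep v (insert e (Y \<inter> W))"
    using lin_indep_insert e(2) lin_indep_subset[OF Y] by (metis inf_le1)
  then obtain Z where Z: "insert e (Y \<inter> W) \<subseteq> Z" "Z \<subseteq> insert e Y" "lin_indep v Z"
    and sp: "span (v ` Z) = span (v ` insert e Y)"
    using lin_indep_extend[of v _ "insert e Y"] by (metis inf_le1 insert_mono)
  have sp': "span (v ` Z) = span (v ` Y)" using sp e(1) by (simp add: span_redundant)
  then have "card Z = card Y" using card_lin_indep Z(3) Y by (metis dim_span)
  then have "card (insert e Y - Z) = 1"
    unfolding card_Diff_subset[OF finite Z(2)] using eY by simp
  then obtain t where t: "insert e Y - Z = {t}" by (metis card_1_singletonE)
  then have "Z = insert e Y - {t}" "t \<noteq> e" using Z by auto
  then have "Z = insert e (Y - {t})" by auto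
  moreover have "t \<in> Y - W" using t Z by auto
  ultimately show thesis using that eY Z(3) sp' by blast
qed

text \<open>If \<open>Y \<inter> W\<close> failed to span some \<open>e\<close> in \<open>W\<close>,
  an exchange would bring \<open>e\<close> in at the cost of an element outside \<open>W\<close>.
  This is used for level sets of a weight, for parity classes and for complements of gaps.\<close>

lemma dim_eq_card_Int_of_no_exchange:
  assumes Y: "lin_indep v Y" "Y \<subseteq> S" "span (v ` Y) = span (v ` S)" and "W \<subseteq> S"
    and no: "\<And>t e. \<lbrakk>t \<in> Y - W; e \<in> W; e \<notin> Y; lin_indep v (insert e (Y - {t}));
      span (v ` insert e (Y - {t})) = span (v ` Y)\<rbrakk> \<Longrightarrow> False"
  shows "dim (v ` W) = card (Y \<inter> W)"
proof -
  have "v e \<in> span (v ` (Y \<inter> W))" if "e \<in> W" for e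
  proof (rule ccontr)
    assume "v e \<notin> span (v ` (Y \<inter> W))"
    moreover have "v e \<in> span (v ` Y)" using that \<open>W \<subseteq> S\<close> unfolding Y(3) by (auto intro: span_base)
    ultimately show False using lin_indep_exchange[OF Y(1) _ _ that] no that by metis
  qed
  then have "span (v ` W) = span (v ` (Y \<inter> W))"
    unfolding span_eq by (auto intro: span_base)
  moreover have "lin_indep v (Y \<inter> W)" using lin_indep_subset[OF Y(1)] by simp
  ultimately show ?thesis using card_lin_indep by (metis dim_span)
qed

section \<open>Bases and rank function of a represented matroid\<close>

definition basis_set :: "('n::finite \<Rightarrow> 'v::euclidean_space) \<Rightarrow> 'n set \<Rightarrow> bool" where
  "basis_set v B \<longleftrightarrow> lin_indep v B \<and> span (v ` B) = UNIV"

lemma card_basis_set: "basis_set v B \<Longrightarrow> card B = DIM('v)" for v :: "'n::finite \<Rightarrow> 'v::euclidean_space"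
  unfolding basis_set_def using card_lin_indep dim_UNIV by (metis dim_span)

lemma basis_setI_span:
  fixes v :: "'n::finite \<Rightarrow> 'v::euclidean_space"
  assumes "span (v ` B) = UNIV" "card B = DIM('v)"
  shows "basis_set v B"
proof -
  have d: "DIM('v) \<le> card (v ` B)"
    using assms(1) by (metis dim_UNIV dim_le_card finite finite_imageI subset_UNIV)
  then have c: "card (v ` B) = card B" using assms(2) card_image_le[of B v] by simp
  then have "inj_on v B" by (simp add: eq_card_imp_inj_on)
  moreover have "independent (v ` B)"
    using assms c by (intro card_le_dim_spanning[of _ UNIV]) (auto simp: dim_UNIV)
  ultimately show ?thesis using assms by (simp add: basis_set_def lin_indep_def)
qed

lemma indep_iff_lin_indep:
  assumes M: "M = {B. basis_set v B}" and sp: "span (range v) = UNIV"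
  shows "indep M X \<longleftrightarrow> lin_indep v X"
proof
  assume "indep M X" then show "lin_indep v X"
    using lin_indep_subset by (auto simp: indep_def M basis_set_def)
next
  assume "lin_indep v X"
  then obtain B where "X \<subseteq> B" "lin_indep v B" "span (v ` B) = span (range v)"
    using lin_indep_extend[of v X UNIV] by auto
  then show "indep M X" using sp by (auto simp: indep_def M basis_set_def)
qed

lemma rk_eq_dim:
  assumes M: "M = {B. basis_set v B}" and sp: "span (range v) = UNIV"
  shows "rk M S = dim (v ` S)"
proof -
  have "Max {card X | X. X \<subseteq> S \<and> lin_indep v X} = dim (v ` S)"
  proof (rule Max_eqI)
    fix y assume "y \<in> {card X | X. X \<subseteq> S \<and> lin_indep v X}"
    then obtain X where "y = card X" "X \<subseteq> S" "lin_indep v X" by blast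
    then show "y \<le> dim (v ` S)" by (simp add: card_lin_indep dim_subset image_mono)
  next
    obtain Y where "Y \<subseteq> S" "lin_indep v Y" "span (v ` Y) = span (v ` S)"
      using lin_indep_extend[OF lin_indep_empty empty_subsetI] by metis
    then have "Y \<subseteq> S \<and> lin_indep v Y \<and> dim (v ` S) = card Y"
      by (metis card_lin_indep dim_span)
    then show "dim (v ` S) \<in> {card X | X. X \<subseteq> S \<and> lin_indep v X}" by blast
  qed simp
  then show ?thesis unfolding rk_def indep_iff_lin_indep[OF assms] .
qed

text \<open>Layer-cake decomposition: \<open>c\<close> is a constant plus a nonnegative combination
  of indicators of its upper level sets. The constant contributes nothing since \<open>y\<close>
  sums to zero.\<close>

lemma sum_mult_nonpos_upper_levels:
  fixes c y :: "'n::finite \<Rightarrow> real"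
  assumes "\<And>t. sum y {i. t \<le> c i} \<le> 0" "sum y UNIV = 0"
  shows "(\<Sum>i\<in>UNIV. c i * y i) \<le> 0"
  using assms(1)
proof (induction "card (range c)" arbitrary: c rule: less_induct)
  case less
  define m where "m = Max (range c)"
  have le: "c i \<le> m" for i by (simp add: m_def)
  have "m \<in> range c" unfolding m_def by (rule Max_in) auto
  show ?case
  proof (cases "range c = {m}")
    case True
    then have "c i = m" for i by auto
    then show ?thesis using assms(2) by (simp flip: sum_distrib_left)
  next
    case False
    \<comment> \<open>\<open>k\<close> is the second largest value. Cutting \<open>c\<close> off at
      \<open>k\<close> removes \<open>m\<close> from the range, and what is cut off is
      \<open>m - k\<close> times the indicator of the top level set.\<close>
    define k where "k = Max (range c - {m})"
    have ne: "range c - {m} \<noteq> {}" using False \<open>m \<in> range c\<close> by auto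
    have k: "k \<in> range c - {m}" unfolding k_def using ne by (intro Max_in) auto
    have k2: "c i \<le> k" if "c i \<noteq> m" for i unfolding k_def using that by (intro Max_ge) auto
    have km: "k < m" using k le by (metis DiffE imageE insertI1 order_le_less)
    define c' where "c' = (\<lambda>i. min (c i) k)"
    have c': "c' i = (if c i = m then k else c i)" for i
      using k2[of i] km by (auto simp: c'_def)
    have "range c' \<subseteq> range c - {m}" using k by (auto simp: c')
    then have "card (range c') < card (range c)"
      using \<open>m \<in> range c\<close> by (intro psubset_card_mono) auto
    moreover have "sum y {i. t \<le> c' i} \<le> 0" for t
    proof (cases "t \<le> k")
      case True
      then have "{i. t \<le> c' i} = {i. t \<le> c i}" by (auto simp: c'_def)
      then show ?thesis using less.prems by simp
    next
      case False
      then have "{i. t \<le> c' i} = {}" by (auto simp: c'_def)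
      then show ?thesis by simp
    qed
    ultimately have IH: "(\<Sum>i\<in>UNIV. c' i * y i) \<le> 0" using less.hyps by blast
    have "c i * y i = c' i * y i + (m - k) * (if m \<le> c i then y i else 0)" for i
      using le[of i] by (auto simp: c' algebra_simps)
    then have "(\<Sum>i\<in>UNIV. c i * y i) = (\<Sum>i\<in>UNIV. c' i * y i) + (m - k) * sum y {i. m \<le> c i}"
      by (simp add: sum.distrib sum_distrib_left[symmetric] sum.If_cases)
    then show ?thesis using IH less.prems[of m] km by (simp add: mult_nonneg_nonpos add_nonpos_nonpos)
  qed
qed

lemma sum_axis_nth: "(\<Sum>i\<in>B. axis i (1::real)) $ k = of_bool (k \<in> B)"
  for B :: "'n::finite set"
  by (simp add: axis_def of_bool_def sum.delta)

text \<open>A basis of maximal weight meets every upper level set of the weight in a basis of that set.\<close>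

lemma matroid_polytopeI:
  fixes v :: "'n::finite \<Rightarrow> 'v::euclidean_space" and x :: "real ^ 'n"
  assumes M: "M = {B. basis_set v B}" and sp: "span (range v) = UNIV"
    and total: "(\<Sum>i\<in>UNIV. x $ i) = DIM('v)"
    and le: "\<And>S. (\<Sum>i\<in>S. x $ i) \<le> dim (v ` S)"
  shows "x \<in> matroid_polytope M"
proof (rule ccontr)
  assume "x \<notin> matroid_polytope M"
  moreover have "closed (matroid_polytope M)" "convex (matroid_polytope M)"
    unfolding matroid_polytope_def
    by (auto intro!: compact_imp_closed finite_imp_compact_convex_hull finite_imageI)
  ultimately obtain a b where ax: "a \<bullet> x < b" and aB: "\<And>z. z \<in> matroid_polytope M \<Longrightarrow> b < a \<bullet> z"
    using separating_hyperplane_closed_point[of "matroid_polytope M" x] by blast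
  \<comment> \<open>\<open>x\<close> lies strictly below the polytope in direction \<open>a\<close>,
    so the weight \<open>c\<close> is larger at \<open>x\<close> than at any vertex. A basis
    \<open>B\<close> of maximal weight will contradict this.\<close>
  define c where "c = (\<lambda>i. - a $ i)"
  obtain B0 where "lin_indep v B0" "span (v ` B0) = span (range v)"
    using lin_indep_extend[OF lin_indep_empty, of UNIV v] by auto
  then have "M \<noteq> {}" using sp by (auto simp: M basis_set_def)
  then have "Max (sum c ` M) \<in> sum c ` M" by (intro Max_in) auto
  then obtain B where B: "B \<in> M" and Bmax: "Max (sum c ` M) = sum c B" by blast
  have max: "sum c C \<le> sum c B" if "C \<in> M" for C
    using that by (simp flip: Bmax)
  have Bb: "lin_indep v B" "span (v ` B) = UNIV" using B by (auto simp: M basis_set_def)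
  have lev: "dim (v ` {i. t \<le> c i}) = card (B \<inter> {i. t \<le> c i})" for t
  proof (rule dim_eq_card_Int_of_no_exchange[OF Bb(1), where S = UNIV])
    fix f e assume h: "f \<in> B - {i. t \<le> c i}" "e \<in> {i. t \<le> c i}" "e \<notin> B"
      "lin_indep v (insert e (B - {f}))" "span (v ` insert e (B - {f})) = span (v ` B)"
    then have "insert e (B - {f}) \<in> M" using Bb by (auto simp: M basis_set_def)
    then have "sum c (insert e (B - {f})) \<le> sum c B" by (rule max)
    moreover have "sum c (insert e (B - {f})) = sum c B + c e - c f"
      using h by (simp add: sum_diff1)
    ultimately show False using h by auto
  qed (use Bb sp in auto)
  let ?e = "\<Sum>i\<in>B. axis i (1::real)"
  have "(\<Sum>i\<in>UNIV. c i * (x $ i - ?e $ i)) \<le> 0"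
  proof (rule sum_mult_nonpos_upper_levels)
    show "(\<Sum>i | t \<le> c i. x $ i - ?e $ i) \<le> 0" for t
      using le[of "{i. t \<le> c i}"] unfolding sum_axis_nth lev sum_subtractf
      by (simp add: Int_commute)
    show "(\<Sum>i\<in>UNIV. x $ i - ?e $ i) = 0"
      using total card_basis_set[of v B] B unfolding sum_axis_nth sum_subtractf by (simp add: M)
  qed
  then have "a \<bullet> ?e \<le> a \<bullet> x"
    by (simp add: inner_vec_def c_def algebra_simps sum_subtractf sum_negf)
  moreover have "?e \<in> matroid_polytope M" unfolding matroid_polytope_def using B by (auto intro!: hull_inc)
  ultimately show False using ax aB by fastforce
qed

section \<open>Signs of maximal minors\<close>

text \<open>The chosen vectors are the rows, so this is the minor transposed. \<open>f\<close> need
  not be increasing, since exchanges disturb the order of the columns.\<close>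

definition column_det :: "('n \<Rightarrow> real ^ 'd) \<Rightarrow> ('d::finite \<Rightarrow> 'n) \<Rightarrow> real" where
  "column_det v f = det (\<chi> j. v (f j))"

lemma column_det_nonzero_iff:
  fixes v :: "'n::finite \<Rightarrow> real ^ 'd::finite"
  assumes "inj f"
  shows "column_det v f \<noteq> 0 \<longleftrightarrow> basis_set v (range f)"
proof -
  have "rows (\<chi> j. v (f j)) = v ` range f"
    by (auto simp: rows_def row_def)
  then have "column_det v f \<noteq> 0 \<longleftrightarrow> span (v ` range f) = UNIV"
    using invertible_det_nz[of "\<chi> j. v (f j)"]
    by (simp add: column_det_def invertible_left_inverse matrix_left_invertible_span_rows)
  moreover have "card (range f) = DIM(real ^ 'd)"
    using assms by (simp add: card_image)
  ultimately show ?thesis using basis_setI_span by (metis basis_set_def)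
qed

lemma column_det_swap:
  assumes "j \<noteq> k"
  shows "column_det v (f(j := y, k := z)) = - column_det v (f(j := z, k := y))"
proof -
  let ?A = "\<chi> i. v ((f(j := z, k := y)) i)"
  have "(\<chi> i. v ((f(j := y, k := z)) i)) = (\<chi> i. ?A $ Transposition.transpose j k i)"
    using assms by (auto simp: vec_eq_iff Transposition.transpose_def)
  then show ?thesis
    using det_permute_rows[of "Transposition.transpose j k" ?A] assms
    by (simp add: column_det_def permutes_swap_id sign_swap_id)
qed

text \<open>Modulo the span of the other rows, the new row is \<open>c\<close> times the old one,
  and the determinant is blind to that span.\<close>

lemma column_det_replace:
  fixes v :: "'n \<Rightarrow> real ^ 'd::finite"
  assumes "w - c *\<^sub>R v (f j) \<in> span (v ` f ` (UNIV - {j}))" "v y = w"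
  shows "column_det v (f(j := y)) = c * column_det v f"
proof -
  \<comment> \<open>Row \<open>j\<close> of \<open>?A\<close> is already scaled by \<open>c\<close>;
    adding an element of the span of the other rows turns \<open>?A\<close> into the matrix of
    \<open>f(j := y)\<close>.\<close>
  let ?A = "(\<chi> i. if i = j then c *s v (f i) else v (f i)) :: real ^ 'd ^ 'd"
  have rA: "row i ?A = (if i = j then c *s v (f i) else v (f i))" for i
    by (simp add: row_def vec_eq_iff)
  have "{row i ?A |i. i \<noteq> j} = v ` f ` (UNIV - {j})"
    by (auto simp: rA)
  then have "w - c *\<^sub>R v (f j) \<in> vec.span {row i ?A |i. i \<noteq> j}"
    using assms(1) by (simp add: span_vec_eq)
  then have "det (\<chi> k. if k = j then row j ?A + (w - c *\<^sub>R v (f j)) else row k ?A) = det ?A"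
    by (rule det_row_span)
  moreover have "(\<chi> k. if k = j then row j ?A + (w - c *\<^sub>R v (f j)) else row k ?A)
      = (\<chi> i. v ((f(j := y)) i))"
    using assms(2) by (auto simp: vec_eq_iff rA scalar_mult_eq_scaleR)
  moreover have "det ?A = c * column_det v f"
  proof -
    have "(\<chi> i. if i = j then v (f i) else v (f i)) = (\<chi> i. v (f i))" by (simp add: vec_eq_iff)
    moreover have "?A = (\<chi> i. if i = j then c *s (\<lambda>i. v (f i)) i else v (f i))" ..
    ultimately show ?thesis unfolding column_det_def by (simp only: det_row_mul)
  qed
  ultimately show ?thesis by (simp add: column_det_def)
qed

lemma ex_strict_mono_range:
  fixes B :: "'n::{finite,linorder} set"
  assumes "card B = CARD('d::{finite,linorder})"
  obtains f :: "'d::{finite,linorder} \<Rightarrow> 'n" where "strict_mono f" "range f = B"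
proof -
  define f where "f = (\<lambda>i::'d. sorted_list_of_set B ! card {j. j < i})"
  have less: "card {j. j < i} < card B" for i :: 'd
    unfolding assms by (rule psubset_card_mono) auto
  have mono: "strict_mono f"
  proof (rule strict_monoI)
    fix i i' :: 'd assume "i < i'"
    then have "card {j. j < i} < card {j. j < i'}"
      by (intro psubset_card_mono) auto
    then show "f i < f i'"
      using less[of i'] sorted_wrt_nth_less[OF strict_sorted_list_of_set[of B]]
      by (simp add: f_def)
  qed
  have "range f \<subseteq> B"
    using less nth_mem[of _ "sorted_list_of_set B"] by (fastforce simp: f_def)
  moreover have "card (range f) = card B"
    using assms mono by (simp add: card_image strict_mono_imp_inj_on)
  ultimately have "range f = B" by (simp add: card_subset_eq)
  with mono that show thesis by blast
qed

text \<open>Sorting the columns after the replacement moves the new column past the columns strictly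
  between \<open>f j\<close> and \<open>a'\<close>.\<close>

lemma column_det_replace_sign:
  fixes v :: "'n::{finite,linorder} \<Rightarrow> real ^ 'd::{finite,linorder}"
  assumes pos: "\<And>f. strict_mono f \<Longrightarrow> 0 \<le> column_det v f"
    and "strict_mono f" "f j < a'" "a' \<notin> range f"
  shows "0 \<le> (- 1) ^ card {b \<in> range f. f j < b \<and> b < a'} * column_det v (f(j := a'))"
  using assms(2-)
proof (induction "card {b \<in> range f. f j < b \<and> b < a'}" arbitrary: f a')
  case 0
  then have none: "{b \<in> range f. f j < b \<and> b < a'} = {}" by simp
  \<comment> \<open>No column lies between, so the list stays increasing and \<open>pos\<close>
    applies directly.\<close>
  have "strict_mono (f(j := a'))"
  proof (rule strict_monoI)
    fix i k :: 'd assume ik: "i < k"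
    have "f i < f k" using strict_monoD[OF 0(2) ik] .
    moreover have "\<not> (f j < f k \<and> f k < a')" "f k \<noteq> a'" using none 0(4) by blast+
    then have "f k \<le> f j \<or> a' < f k" by (metis linorder_neqE not_le)
    ultimately show "(f(j := a')) i < (f(j := a')) k" using ik 0
      by (auto simp: not_less)
  qed
  then have "0 \<le> column_det v (f(j := a'))" by (rule pos)
  then show ?case unfolding none by (simp del: fun_upd_apply)
next
  case (Suc m)
  let ?S = "{b \<in> range f. f j < b \<and> b < a'}"
  \<comment> \<open>\<open>z\<close> is the last column before \<open>a'\<close>. Moving it to
    \<open>a'\<close> keeps the list increasing (\<open>g\<close>) and leaves one column fewer
    between \<open>g j\<close> and \<open>z\<close>. Then \<open>g(j := z)\<close> and
    \<open>f(j := a')\<close> differ by one transposition, which supplies the sign.\<close>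
  define z where "z = Max ?S"
  have "?S \<noteq> {}" using Suc(2) by force
  then have "z \<in> ?S" unfolding z_def by (intro Max_in) auto
  then obtain k where z: "z = f k" "f j < z" "z < a'" by auto
  have zmax: "b \<le> z" if "b \<in> ?S" for b unfolding z_def using that by (intro Max_ge) auto
  have jk: "j \<noteq> k" using z by auto
  define g where "g = f(k := a')"
  have mono_g: "strict_mono g"
  proof (rule strict_monoI)
    fix i l :: 'd assume il: "i < l"
    have "f i < f l" using strict_monoD[OF Suc(3) il] .
    moreover have "f l \<le> z \<or> a' < f l" using zmax[of "f l"] z Suc by force
    ultimately show "g i < g l" using il z
      by (auto simp: g_def)
  qed
  have inj: "inj f" using Suc(3) by (rule strict_mono_imp_inj_on)
  have rg: "range g = insert a' (range f - {z})"
    using inj by (auto simp: g_def z inj_def)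
  have S: "{b \<in> range g. g j < b \<and> b < z} = ?S - {z}"
    using jk z zmax by (force simp: rg g_def)
  have "m = card {b \<in> range g. g j < b \<and> b < z}"
    unfolding S using Suc(2) \<open>z \<in> ?S\<close> by simp
  moreover have "g j < z" "z \<notin> range g" using jk z unfolding rg by (auto simp: g_def)
  ultimately have "0 \<le> (- 1) ^ m * column_det v (g(j := z))"
    using Suc(1)[OF _ mono_g] by metis
  moreover have "column_det v (g(j := z)) = - column_det v (f(j := a'))"
    using column_det_swap[OF jk, of v f a' z] jk z by (simp add: g_def fun_upd_twist fun_upd_idem)
  ultimately show ?case using Suc(2) by (simp flip: Suc(2))
qed

text \<open>Cramer's rule: \<open>c\<close> is the determinant with \<open>a'\<close> in the place
  of \<open>a\<close>, divided by the positive minor of \<open>B\<close>. Re-sorting the columns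
  costs the stated sign.\<close>

lemma exchange_coefficient_sign:
  fixes v :: "'n::{finite,linorder} \<Rightarrow> real ^ 'd::{finite,linorder}"
  assumes pos: "\<And>f :: 'd \<Rightarrow> 'n. strict_mono f \<Longrightarrow> 0 \<le> column_det v f"
    and B: "basis_set v B" "insert a Z \<subseteq> B" "a \<notin> Z" "a' \<notin> B" "a < a'"
    and c: "v a' - c *\<^sub>R v a \<in> span (v ` Z)"
  shows "0 \<le> (- 1) ^ card {b \<in> B. a < b \<and> b < a'} * c"
proof -
  have "card B = CARD('d)" using card_basis_set[OF B(1)] by simp
  then obtain f :: "'d \<Rightarrow> 'n" where f: "strict_mono f" "range f = B"
    by (rule ex_strict_mono_range)
  have inj: "inj f" using f(1) by (rule strict_mono_imp_inj_on)
  obtain j where j: "f j = a" using f(2) B(2) by blast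
  have "Z \<subseteq> f ` (UNIV - {j})"
    using B(2,3) f(2) j by (force simp: image_iff)
  then have "v a' - c *\<^sub>R v (f j) \<in> span (v ` f ` (UNIV - {j}))"
    using c j span_mono image_mono by (metis subsetD)
  then have "column_det v (f(j := a')) = c * column_det v f"
    by (rule column_det_replace) simp
  moreover have "0 < column_det v f"
    using pos[OF f(1)] column_det_nonzero_iff[OF inj, of v] B(1) f(2) by (simp add: order_less_le)
  moreover have "0 \<le> (- 1) ^ card {b \<in> B. a < b \<and> b < a'} * column_det v (f(j := a'))"
    using column_det_replace_sign[OF pos f(1), of j a'] f(2) j B by simp
  ultimately show ?thesis
    by (simp add: mult.assoc[symmetric] zero_le_mult_iff)
qed

section \<open>Rank inequalities from cyclic intervals\<close>

lemma basis_set_replace: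
  assumes "basis_set v (X \<union> R)" "X \<inter> R = {}" "card Y = card X" "Y \<inter> R = {}"
    "span (v ` Y) = span (v ` X)"
  shows "basis_set v (Y \<union> R)"
proof (rule basis_setI_span)
  have "span (v ` (Y \<union> R)) = span (v ` (X \<union> R))"
    using assms(5) unfolding image_Un span_Un by simp
  then show "span (v ` (Y \<union> R)) = UNIV" using assms(1) by (simp add: basis_set_def)
  show "card (Y \<union> R) = DIM('b)"
    using card_basis_set[OF assms(1)] assms by (simp add: card_Un_disjoint)
qed

text \<open>The coefficient \<open>c\<close> of \<open>v a\<close> in \<open>v a'\<close> is read
  off modulo the span of \<open>Z\<close>, without reference to \<open>R\<close>. Its sign fixes the
  parity of the number of elements of \<open>Z\<close> and \<open>R\<close> between \<open>a\<close>
  and \<open>a'\<close>, so \<open>R1\<close> and \<open>R2\<close> must agree.\<close>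

lemma exchange_parity_aux:
  fixes v :: "'n::{finite,linorder} \<Rightarrow> real ^ 'd::{finite,linorder}"
  assumes pos: "\<And>f :: 'd \<Rightarrow> 'n. strict_mono f \<Longrightarrow> 0 \<le> column_det v f"
    and B: "\<And>R. R \<in> {R1, R2} \<Longrightarrow> basis_set v (insert a Z \<union> R)"
    and a: "a < a'" "a \<notin> Z" "a' \<notin> Z" "lin_indep v (insert a' Z)"
    and sp: "v a' \<in> span (v ` insert a Z)"
    and disj: "\<And>R. R \<in> {R1, R2} \<Longrightarrow> insert a (insert a' Z) \<inter> R = {}"
  shows "even (card {r \<in> R1. a < r \<and> r < a'} + card {r \<in> R2. a < r \<and> r < a'})"
proof -
  obtain c where c: "v a' - c *\<^sub>R v a \<in> span (v ` Z)"
    using sp by (auto simp: span_breakdown_eq)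
  have "v a' \<notin> span (v ` Z)" using a lin_indep_insertD by blast
  then have "c \<noteq> 0" using c by auto
  have 1: "0 < (- 1) ^ (card {b \<in> Z. a < b \<and> b < a'} + card {r \<in> R. a < r \<and> r < a'}) * c"
    if R: "R \<in> {R1, R2}" for R
  proof -
    have "0 \<le> (- 1) ^ card {b \<in> insert a Z \<union> R. a < b \<and> b < a'} * c"
      using disj[OF R] a by (intro exchange_coefficient_sign[OF pos B[OF R] _ a(2) _ a(1) c]) auto
    moreover have "{b \<in> insert a Z \<union> R. a < b \<and> b < a'}
        = {b \<in> Z. a < b \<and> b < a'} \<union> {r \<in> R. a < r \<and> r < a'}" by auto
    moreover have "card ({b \<in> Z. a < b \<and> b < a'} \<union> {r \<in> R. a < r \<and> r < a'})
        = card {b \<in> Z. a < b \<and> b < a'} + card {r \<in> R. a < r \<and> r < a'}"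
      using disj[OF R] by (intro card_Un_disjoint) auto
    ultimately show ?thesis using \<open>c \<noteq> 0\<close> by (simp add: order_less_le)
  qed
  show ?thesis using 1[of R1] 1[of R2]
    by (cases "even (card {b \<in> Z. a < b \<and> b < a'})";
        cases "even (card {r \<in> R1. a < r \<and> r < a'})";
        cases "even (card {r \<in> R2. a < r \<and> r < a'})") (auto simp: power_add)
qed

text \<open>Counts between \<open>t\<close> and \<open>e\<close> are differences of counts below
  them. Counting below makes the parity a function of a single point that is unchanged along
  exchanges.\<close>

lemma exchange_parity:
  fixes v :: "'n::{finite,linorder} \<Rightarrow> real ^ 'd::{finite,linorder}"
  assumes pos: "\<And>f :: 'd \<Rightarrow> 'n. strict_mono f \<Longrightarrow> 0 \<le> column_det v f"
    and B: "\<And>R. R \<in> {R1, R2} \<Longrightarrow> basis_set v (T \<union> R)"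
    and ex: "t \<in> T" "e \<notin> T" "lin_indep v (insert e (T - {t}))"
      "span (v ` insert e (T - {t})) = span (v ` T)"
    and disj: "\<And>R. R \<in> {R1, R2} \<Longrightarrow> insert e T \<inter> R = {}"
  shows "even (card {r \<in> R1. r < t} + card {r \<in> R2. r < t}) \<longleftrightarrow>
    even (card {r \<in> R1. r < e} + card {r \<in> R2. r < e})"
proof -
  have T: "insert t (T - {t}) = T" using ex by auto
  have B': "basis_set v (insert e (T - {t}) \<union> R)" if R: "R \<in> {R1, R2}" for R
  proof (rule basis_set_replace[OF B[OF R] _ _ _ ex(4)])
    show "card (insert e (T - {t})) = card T"
      using ex by (metis DiffD1 card_Suc_Diff1 card_insert_disjoint finite)
  qed (use disj[OF R] in auto)
  have split: "card {r \<in> R. r < y} = card {r \<in> R. r < x} + card {r \<in> R. x < r \<and> r < y}"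
    if "x < y" "x \<notin> R" for x y and R :: "'n set"
  proof -
    have eq: "{r \<in> R. r < y} = {r \<in> R. r < x} \<union> {r \<in> R. x < r \<and> r < y}"
      using that by (auto simp: not_less le_less)
    show ?thesis unfolding eq by (rule card_Un_disjoint) auto
  qed
  have Tind: "lin_indep v T" using B[of R1] lin_indep_subset[of v "T \<union> R1" T] by (simp add: basis_set_def)
  have n: "t \<notin> R1" "t \<notin> R2" "e \<notin> R1" "e \<notin> R2" "t \<noteq> e" using disj[of R1] disj[of R2] ex by auto
  show ?thesis
  proof (cases "t < e")
    case True
    have "basis_set v (insert t (T \<union> R1))" "basis_set v (insert t (T \<union> R2))"
      using B[of R1] B[of R2] ex(1) by (simp_all add: insert_absorb)
    then have "even (card {r \<in> R1. t < r \<and> r < e} + card {r \<in> R2. t < r \<and> r < e})"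
      using ex disj True span_base[of "v e" "v ` insert e (T - {t})"]
      by (intro exchange_parity_aux[OF pos, where Z = "T - {t}"]) (auto simp: T)
    then show ?thesis using split[OF True, of R1] split[OF True, of R2] n by auto
  next
    case False
    \<comment> \<open>Now the exchange is read backwards, from \<open>insert e (T - {t})\<close> to
      \<open>T\<close>.\<close>
    then have et: "e < t" using n by auto
    have "lin_indep v (insert t T)" using Tind ex(1) by (simp add: insert_absorb)
    then have "even (card {r \<in> R1. e < r \<and> r < t} + card {r \<in> R2. e < r \<and> r < t})"
      using ex disj et B' span_base[of "v t" "v ` T"]
      by (intro exchange_parity_aux[OF pos, where Z = "T - {t}"]) (auto simp: T)
    then show ?thesis using split[OF et, of R1] split[OF et, of R2] n by auto
  qed
qed

text \<open>The element of \<open>A\<close> that precedes \<open>y\<close> cyclically; it wraps to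
  the maximum if no element of \<open>A\<close> is below \<open>y\<close>. Its fibres outside
  \<open>A\<close> are the cyclic gaps of \<open>A\<close>.\<close>

definition cyc_pred :: "'n::linorder set \<Rightarrow> 'n \<Rightarrow> 'n" where
  "cyc_pred A y = Max (if {a \<in> A. a < y} = {} then A else {a \<in> A. a < y})"

lemma cyc_pred_in: "finite A \<Longrightarrow> A \<noteq> {} \<Longrightarrow> cyc_pred A y \<in> A"
proof -
  assume A: "finite A" "A \<noteq> {}"
  then have "cyc_pred A y \<in> (if {a \<in> A. a < y} = {} then A else {a \<in> A. a < y})"
    unfolding cyc_pred_def by (intro Max_in) auto
  then show ?thesis by (auto split: if_splits)
qed

text \<open>The complement of the gap runs from the cyclic successor \<open>s\<close> of
  \<open>c\<close> in \<open>A\<close>, which wraps to the minimum, round to \<open>c\<close>. This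
  includes the cases of an empty gap and of a singleton \<open>A\<close>.\<close>

lemma Compl_gap_eq_cyc_interval:
  fixes A :: "'n::{finite,linorder} set"
  assumes "c \<in> A"
  shows "\<exists>a b. - {y. y \<notin> A \<and> cyc_pred A y = c} = cyc_interval a b"
proof -
  define s where "s = Min (if {a \<in> A. c < a} = {} then A else {a \<in> A. c < a})"
  have pred_iff: "cyc_pred A y = c \<longleftrightarrow> (if \<exists>a\<in>A. a < y then c < y \<and> (\<forall>a\<in>A. a < y \<longrightarrow> a \<le> c) else \<forall>a\<in>A. a \<le> c)" for y
    unfolding cyc_pred_def using assms by (auto simp: Max_eq_iff intro!: Max_eqI)
  have s_in: "s \<in> (if {a \<in> A. c < a} = {} then A else {a \<in> A. c < a})"
    unfolding s_def using assms by (intro Min_in) auto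
  have s_le: "s \<le> a" if "a \<in> (if {a \<in> A. c < a} = {} then A else {a \<in> A. c < a})" for a
    unfolding s_def using that by (intro Min_le) auto
  have "- {y. y \<notin> A \<and> cyc_pred A y = c} = cyc_interval s c"
  proof (cases "{a \<in> A. c < a} = {}")
    case True
    then have s: "s \<in> A" "\<And>a. a \<in> A \<Longrightarrow> s \<le> a" and c: "\<And>a. a \<in> A \<Longrightarrow> a \<le> c"
      using s_in s_le by (auto simp: not_less)
    have "y \<notin> A \<and> cyc_pred A y = c \<longleftrightarrow> y < s \<or> c < y" for y
    proof (cases "y < s")
      case True
      then have "\<forall>a\<in>A. \<not> a < y" using s(2) by force
      moreover have "y \<notin> A" using s(2) True by force
      ultimately show ?thesis unfolding pred_iff using True c by simp
    next
      case False
      show ?thesis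
      proof (cases "y \<in> A")
        case True
        then show ?thesis using \<open>\<not> y < s\<close> c by (auto simp: not_less)
      next
        case False
        then have "s < y" using \<open>\<not> y < s\<close> s(1) by (metis linorder_neqE)
        then have "\<exists>a\<in>A. a < y" using s(1) by blast
        then show ?thesis unfolding pred_iff using \<open>\<not> y < s\<close> False c by simp
      qed
    qed
    then have gap: "{y. y \<notin> A \<and> cyc_pred A y = c} = {y. y < s \<or> c < y}" by (simp only:)
    show ?thesis unfolding gap using s(2)[OF assms] by (auto simp: cyc_interval_def cyc_le_def not_less)
  next
    case False
    then have s: "s \<in> A" "c < s" "\<And>a. a \<in> A \<Longrightarrow> c < a \<Longrightarrow> s \<le> a"
      using s_in s_le unfolding if_not_P[OF False] by auto
    have "y \<notin> A \<and> cyc_pred A y = c \<longleftrightarrow> c < y \<and> y < s" for y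
      unfolding pred_iff using s assms by (metis leD le_less_linear less_trans not_less_iff_gr_or_eq)
    then have gap: "{y. y \<notin> A \<and> cyc_pred A y = c} = {y. c < y \<and> y < s}" by (simp only:)
    show ?thesis unfolding gap using s(2) by (auto simp: cyc_interval_def cyc_le_def not_less)
  qed
  then show ?thesis by blast
qed

text \<open>The signs of the minors force the parity of \<open>|R \<inter> {r. r < a}|\<close>, for bases \<open>R\<close> of
  the contraction \<open>M / A\<close>, to vary with \<open>R\<close> in the same way for all \<open>a \<in> A\<close>. Hence two elements exchanged in \<open>M / A\<close> are not separated by \<open>A\<close>.\<close>

lemma rank_bound_of_interval_bounds:
  fixes v :: "'n::{finite,linorder} \<Rightarrow> real ^ 'd::{finite,linorder}" and x :: "'n \<Rightarrow> real"
  assumes pos: "\<And>f :: 'd \<Rightarrow> 'n. strict_mono f \<Longrightarrow> 0 \<le> column_det v f"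
    and sp: "span (range v) = UNIV"
    and total: "sum x UNIV = CARD('d)"
    and intervals: "\<And>a b. sum x (cyc_interval a b) \<le> dim (v ` cyc_interval a b)"
  shows "sum x A \<le> dim (v ` A)"
proof (induction A rule: finite_psubset_induct[OF finite])
  case (1 A)
  show ?case
  proof (rule ccontr)
    assume viol: "\<not> sum x A \<le> dim (v ` A)"
    then have "A \<noteq> {}" by auto
    \<comment> \<open>\<open>T\<close> is a basis of \<open>A\<close>, and \<open>Y\<close>
      completes it to a basis of the whole matroid, so \<open>Y - T\<close> is a basis of
      $M/A$.\<close>
    obtain T where T: "T \<subseteq> A" "lin_indep v T" "span (v ` T) = span (v ` A)"
      using lin_indep_extend[OF lin_indep_empty, of A v] by auto
    obtain Y where Y: "T \<subseteq> Y" "lin_indep v Y" "span (v ` Y) = span (range v)"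
      using lin_indep_extend[OF T(2), of UNIV] by auto
    have basis_Y: "basis_set v Y" using Y sp by (simp add: basis_set_def)
    \<comment> \<open>Since \<open>T\<close> spans \<open>A\<close>, an independent set containing
      \<open>T\<close> picks up no further element of \<open>A\<close>.\<close>
    have disjA: "A \<inter> (Z - T) = {}" if "T \<subseteq> Z" "lin_indep v Z" for Z
    proof (rule ccontr)
      assume "A \<inter> (Z - T) \<noteq> {}"
      then obtain e where e: "e \<in> A" "e \<in> Z" "e \<notin> T" by blast
      then have "lin_indep v (insert e T)" using lin_indep_subset that by (metis insert_subset)
      then have "v e \<notin> span (v ` T)" using e lin_indep_insertD by blast
      then show False using e T(3) by (auto intro: span_base)
    qed
    \<comment> \<open>Minimality of \<open>A\<close> enters here. No exchange links the two parity
      classes of \<open>A\<close>, so both ranks and sums add up over them and one class already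
      violates the inequality; it can only be \<open>A\<close> itself.\<close>
    have parity: "even (card {r \<in> R1. r < a} + card {r \<in> R2. r < a}) \<longleftrightarrow>
        even (card {r \<in> R1. r < b} + card {r \<in> R2. r < b})"
      if R: "\<And>R. R \<in> {R1, R2} \<Longrightarrow> basis_set v (T \<union> R) \<and> A \<inter> R = {}" and ab: "a \<in> A" "b \<in> A" for R1 R2 a b
    proof -
      define p where "p = (\<lambda>a. even (card {r \<in> R1. r < a} + card {r \<in> R2. r < a}))"
      have p_ex: "p t = p e" if "t \<in> T" "e \<in> A" "e \<notin> T" "lin_indep v (insert e (T - {t}))"
          "span (v ` insert e (T - {t})) = span (v ` T)" for t e
        unfolding p_def using that R T(1) by (intro exchange_parity[OF pos]) auto
      have dim_part: "dim (v ` {a \<in> A. p a = q}) = card (T \<inter> {a \<in> A. p a = q})" for q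
      proof (rule dim_eq_card_Int_of_no_exchange[OF T(2) T(1) T(3)])
        fix t e assume "t \<in> T - {a \<in> A. p a = q}" "e \<in> {a \<in> A. p a = q}" "e \<notin> T"
          "lin_indep v (insert e (T - {t}))" "span (v ` insert e (T - {t})) = span (v ` T)"
        then show False using p_ex[of t e] T(1) by blast
      qed auto
      have "dim (v ` A) = card T" using T card_lin_indep by (metis dim_span)
      also have "T = (T \<inter> {a \<in> A. p a = True}) \<union> (T \<inter> {a \<in> A. p a = False})" using T(1) by auto
      also have "card \<dots> = card (T \<inter> {a \<in> A. p a = True}) + card (T \<inter> {a \<in> A. p a = False})"
        by (rule card_Un_disjoint) auto
      finally have d: "dim (v ` A) = dim (v ` {a \<in> A. p a = True}) + dim (v ` {a \<in> A. p a = False})"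
        unfolding dim_part .
      have "A = {a \<in> A. p a = True} \<union> {a \<in> A. p a = False}" by auto
      then have "sum x A = sum x ({a \<in> A. p a = True} \<union> {a \<in> A. p a = False})" by simp
      also have "\<dots> = sum x {a \<in> A. p a = True} + sum x {a \<in> A. p a = False}"
        by (rule sum.union_disjoint) auto
      finally have s: "sum x A = sum x {a \<in> A. p a = True} + sum x {a \<in> A. p a = False}" .
      have "\<exists>q. \<not> sum x {a \<in> A. p a = q} \<le> dim (v ` {a \<in> A. p a = q})"
      proof (rule ccontr)
        assume "\<not> ?thesis"
        then have "sum x {a \<in> A. p a = True} \<le> dim (v ` {a \<in> A. p a = True})"
          "sum x {a \<in> A. p a = False} \<le> dim (v ` {a \<in> A. p a = False})" by blast+
        then show False using s d viol by simp
      qed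
      then obtain q where "\<not> sum x {a \<in> A. p a = q} \<le> dim (v ` {a \<in> A. p a = q})" ..
      then have "{a \<in> A. p a = q} = A" using 1(2)[of "{a \<in> A. p a = q}"] by blast
      then have "p a = p b" using ab by auto
      then show ?thesis by (simp add: p_def)
    qed
    define gap where "gap = (\<lambda>c. {y. y \<notin> A \<and> cyc_pred A y = c})"
    define R where "R = Y - T"
    have RA: "A \<inter> R = {}" using disjA Y R_def by simp
    have TR: "T \<union> R = Y" using Y R_def by auto
    \<comment> \<open>No exchange in \<open>Y\<close> trades an element of \<open>gap c\<close> for
      one outside it, so \<open>Y\<close> meets the complement of the gap in a basis of that
      complement.\<close>
    have dim_gap: "dim (v ` (- gap c)) = card (Y \<inter> - gap c)" for c
    proof (rule dim_eq_card_Int_of_no_exchange[OF Y(2) subset_UNIV Y(3) subset_UNIV])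
      fix t e assume h: "t \<in> Y - - gap c" "e \<in> - gap c" "e \<notin> Y" "lin_indep v (insert e (Y - {t}))"
        "span (v ` insert e (Y - {t})) = span (v ` Y)"
      define R2 where "R2 = insert e (R - {t})"
      have t: "t \<in> R" "t \<notin> A" "t \<notin> T" "cyc_pred A t = c" using h(1) T(1) by (auto simp: gap_def R_def)
      have TR2: "T \<union> R2 = insert e (Y - {t})" using t TR by (auto simp: R2_def)
      have eT: "e \<notin> T" "e \<notin> R" using h(3) Y(1) R_def by auto
      have R2: "A \<inter> R2 = {}" "basis_set v (T \<union> R2)"
      proof -
        have "R2 = insert e (Y - {t}) - T" using TR2 t eT by (auto simp: R2_def R_def)
        then show "A \<inter> R2 = {}" using disjA[OF _ h(4)] TR2 by (metis Un_upper1)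
        show "basis_set v (T \<union> R2)" unfolding TR2 using h basis_Y by (simp add: basis_set_def)
      qed
      have par: "even (card {r \<in> R. r < a} + card {r \<in> R2. r < a}) \<longleftrightarrow>
        even (card {r \<in> R. r < b} + card {r \<in> R2. r < b})" if "a \<in> A" "b \<in> A" for a b
        using R2 RA TR basis_Y that by (intro parity) auto
      \<comment> \<open>\<open>R\<close> and \<open>R2\<close> differ only in \<open>t\<close> and
        \<open>e\<close>, so the combined count below \<open>a\<close> is odd exactly when
        \<open>a\<close> separates \<open>t\<close> from \<open>e\<close>.\<close>
      have cnt: "even (card {r \<in> R. r < a} + card {r \<in> R2. r < a}) \<longleftrightarrow> (t < a) = (e < a)" for a
      proof -
        let ?Q = "{r \<in> R - {t}. r < a}"
        have "{r \<in> R. r < a} = (if t < a then insert t ?Q else ?Q)" "{r \<in> R2. r < a} = (if e < a then insert e ?Q else ?Q)"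
          using t by (auto simp: R2_def)
        then show ?thesis using eT t by simp
      qed
      have "e \<notin> A" using R2(1) by (auto simp: R2_def)
      have "cyc_pred A e = cyc_pred A t"
      proof (cases "\<forall>a\<in>A. (t < a) = (e < a)")
        case True
        then have "{a \<in> A. a < e} = {a \<in> A. a < t}"
          using t \<open>e \<notin> A\<close> by (metis (mono_tags, lifting) not_less_iff_gr_or_eq)
        then show ?thesis unfolding cyc_pred_def by (simp only:)
      next
        \<comment> \<open>Every element of \<open>A\<close> separates \<open>t\<close> from
          \<open>e\<close>, so one of them lies below all of \<open>A\<close> and the other above.
          Both belong to the gap that wraps round the end, where \<open>cyc_pred\<close> is the
          maximum of \<open>A\<close>.\<close>
        case False
        then have opp: "(t < a) \<noteq> (e < a)" if "a \<in> A" for a using par cnt that by blast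
        have all: "(if {a \<in> A. a < y} = {} then A else {a \<in> A. a < y}) = A"
          if "y = t \<or> y = e" for y
        proof (cases "t < e")
          case True
          then have "t < a \<and> a < e" if "a \<in> A" for a
            using opp[OF that] t \<open>e \<notin> A\<close> that by (metis less_trans not_less_iff_gr_or_eq)
          then have "{a \<in> A. a < t} = {}" "{a \<in> A. a < e} = A" by force+
          then show ?thesis using that by auto
        next
          case False
          then have "e < a \<and> a < t" if "a \<in> A" for a
            using opp[OF that] t \<open>e \<notin> A\<close> that by (metis less_trans not_less_iff_gr_or_eq)
          then have "{a \<in> A. a < e} = {}" "{a \<in> A. a < t} = A" by force+
          then show ?thesis using that by auto
        qed
        show ?thesis unfolding cyc_pred_def using all[of t] all[of e] by (simp only: simp_thms)
      qed
      then show False using h(2) \<open>e \<notin> A\<close> t by (simp add: gap_def)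
    qed
    \<comment> \<open>Subtracting the interval inequality for the complement of the gap from the
      total leaves a lower bound on the gap itself.\<close>
    have "card (R \<inter> gap c) \<le> sum x (gap c)" if "c \<in> A" for c
    proof -
      have "sum x (- gap c) \<le> dim (v ` (- gap c))"
        using Compl_gap_eq_cyc_interval[OF that] intervals unfolding gap_def by metis
      moreover have "sum x UNIV = sum x (gap c) + sum x (- gap c)"
        using sum.union_disjoint[of "gap c" "- gap c" x] by (simp add: Compl_partition)
      moreover have "card Y = card (Y \<inter> - gap c) + card (R \<inter> gap c)"
      proof -
        have "R \<inter> gap c = Y \<inter> gap c" using T(1) by (auto simp: R_def gap_def)
        then show ?thesis
          using card_Un_disjoint[of "Y \<inter> - gap c" "Y \<inter> gap c"] by (simp flip: Int_Un_distrib)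
      qed
      moreover have "card Y = CARD('d)" using card_basis_set[OF basis_Y] by simp
      ultimately show ?thesis using total dim_gap[of c] by simp
    qed
    then have "(\<Sum>c\<in>A. real (card (R \<inter> gap c))) \<le> (\<Sum>c\<in>A. sum x (gap c))"
      by (rule sum_mono)
    \<comment> \<open>The gaps partition the complement of \<open>A\<close>, so there
      \<open>x\<close> sums to at least \<open>card R\<close>, which is $d$ minus the rank of
      \<open>A\<close>.\<close>
    moreover have fibers: "(\<Sum>c\<in>A. sum h (gap c)) = sum h (- A)" for h :: "'n \<Rightarrow> real"
      using sum.group[of "- A" A "cyc_pred A" h] cyc_pred_in[OF finite \<open>A \<noteq> {}\<close>]
      by (simp add: gap_def image_subset_iff)
    moreover have "(\<Sum>c\<in>A. real (card (R \<inter> gap c))) = card R"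
    proof -
      have "real (card (R \<inter> gap c)) = (\<Sum>r\<in>gap c. of_bool (r \<in> R))" for c
        by (simp add: Int_commute)
      then have "(\<Sum>c\<in>A. real (card (R \<inter> gap c))) = (\<Sum>r\<in>- A. of_bool (r \<in> R))"
        using fibers[of "\<lambda>r. of_bool (r \<in> R)"] by (simp only:)
      moreover have "- A \<inter> R = R" using RA by auto
      ultimately show ?thesis by simp
    qed
    moreover have "sum x UNIV = sum x A + sum x (- A)"
      using sum.union_disjoint[of A "- A" x] by (simp add: Compl_partition)
    moreover have "card T + card R = CARD('d)"
      using card_basis_set[OF basis_Y] card_Un_disjoint[of T R] TR by (simp add: R_def)
    moreover have "card T = dim (v ` A)" using T card_lin_indep by (metis dim_span)
    ultimately show False using viol total by simp
  qed
qed

section \<open>Counting CCW-arrows\<close>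

context
  fixes v :: "'n::{finite,linorder} \<Rightarrow> 'v::euclidean_space" and M :: "'n set set" and \<pi> :: "'n \<Rightarrow> 'n"
  assumes M: "M = {B. basis_set v B}" and spanning: "span (range v) = UNIV"
    and nonzero: "\<And>i. v i \<noteq> 0" and nocoloop: "\<And>i. v i \<in> span (v ` (- {i}))"
    and \<pi>: "\<pi> = decorated_permutation M"
begin

text \<open>The span of the elements after \<open>i\<close> up to \<open>k\<close> grows with
  \<open>k\<close>, so containing \<open>v i\<close> is an upward closed condition in the order
  starting at \<open>i\<close>, and \<open>\<pi> i\<close> is its threshold.\<close>

lemma decorated_permutation_spec:
  shows decorated_permutation_neq: "\<pi> i \<noteq> i"
    and decorated_permutation_le_iff: "k \<noteq> i \<Longrightarrow> cyc_le i (\<pi> i) k \<longleftrightarrow> v i \<in> span (v ` (cyc_interval i k - {i}))"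
proof -
  define P where "P = (\<lambda>j. j \<noteq> i \<and> rk M (cyc_interval i j) = rk M (cyc_interval i j - {i}))"
  have P_iff: "P j \<longleftrightarrow> j \<noteq> i \<and> v i \<in> span (v ` (cyc_interval i j - {i}))" for j
  proof -
    have "insert i (cyc_interval i j - {i}) = cyc_interval i j"
      by (auto simp: cyc_interval_def cyc_le_first)
    then have "dim (v ` cyc_interval i j) = dim (insert (v i) (v ` (cyc_interval i j - {i})))"
      by (metis image_insert)
    then show ?thesis by (auto simp: P_def rk_eq_dim[OF M spanning] dim_insert)
  qed
  \<comment> \<open>\<open>m\<close> is the last element in the order from \<open>i\<close>, so its
    interval is everything. Since \<open>i\<close> is not a coloop, \<open>P\<close> holds at
    \<open>m\<close>, and hence a first such element exists.\<close>
  obtain m where m: "\<And>k. cyc_le i k m"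
    using total_order_min[of UNIV "\<lambda>x y. cyc_le i y x"] cyc_le_total cyc_le_trans by (metis UNIV_I UNIV_not_empty finite)
  have UNIV: "cyc_interval i m = UNIV" using m by (auto simp: cyc_interval_def)
  have "m \<noteq> i"
  proof
    assume "m = i"
    then have "x = i" for x using m cyc_le_first cyc_le_antisym by metis
    then have "- {i} = {}" by blast
    then show False using nocoloop[of i] nonzero[of i] by simp
  qed
  then have "P m" using nocoloop[of i] by (simp add: P_iff UNIV Compl_eq_Diff_UNIV)
  then obtain j where j: "P j" "\<And>k. P k \<Longrightarrow> cyc_le i j k"
    using total_order_min[of "Collect P" "cyc_le i"] cyc_le_total cyc_le_trans
    by (metis empty_iff finite mem_Collect_eq)
  have "\<pi> i = (THE j. P j \<and> (\<forall>k. P k \<longrightarrow> cyc_le i j k))"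
    unfolding \<pi> decorated_permutation_def P_def Let_def ..
  also have "\<dots> = j" using j cyc_le_antisym by (intro the_equality) blast+
  finally have \<pi>j: "\<pi> i = j" .
  then show "\<pi> i \<noteq> i" using j P_iff by simp
  show "cyc_le i (\<pi> i) k \<longleftrightarrow> v i \<in> span (v ` (cyc_interval i k - {i}))" if "k \<noteq> i"
  proof
    assume "cyc_le i (\<pi> i) k"
    then have "cyc_interval i j \<subseteq> cyc_interval i k"
      unfolding \<pi>j cyc_interval_def using cyc_le_trans by blast
    then have "span (v ` (cyc_interval i j - {i})) \<subseteq> span (v ` (cyc_interval i k - {i}))"
      by (intro span_mono image_mono) auto
    then show "v i \<in> span (v ` (cyc_interval i k - {i}))" using j(1) P_iff by blast
  next
    assume "v i \<in> span (v ` (cyc_interval i k - {i}))"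
    then show "cyc_le i (\<pi> i) k" using j(2) that by (simp add: P_iff \<pi>j)
  qed
qed

text \<open>With \<open>W i\<close> strictly between \<open>i\<close> and \<open>\<pi> i\<close>,
  \<open>v i\<close> is spanned by \<open>W i\<close> and \<open>\<pi> i\<close> together but not by
  \<open>W i\<close> alone, so \<open>v (\<pi> i)\<close> is spanned by \<open>i\<close> and
  \<open>W i\<close>. If \<open>i'\<close> between them had the same image,
  \<open>v (\<pi> i)\<close> and then \<open>v i\<close> would fall into the span of
  \<open>W i\<close>.\<close>

lemma inj_decorated_permutation: "inj \<pi>"
proof -
  define W where "W = (\<lambda>i. cyc_interval i (\<pi> i) - {i, \<pi> i})"
  have notin: "v i \<notin> span (v ` W i)" for i
  proof (cases "W i = {}")
    case True then show ?thesis using nonzero by simp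
  next
    case False
    \<comment> \<open>The last element \<open>k\<close> of \<open>W i\<close> still precedes
      \<open>\<pi> i\<close>, so the threshold criterion denies that \<open>v i\<close> is spanned
      up to \<open>k\<close>.\<close>
    then obtain k where k: "k \<in> W i" "\<And>y. y \<in> W i \<Longrightarrow> cyc_le i y k"
      using total_order_min[of "W i" "\<lambda>x y. cyc_le i y x"] cyc_le_total cyc_le_trans by (metis finite)
    then have "W i \<subseteq> cyc_interval i k - {i}" by (auto simp: W_def cyc_interval_def)
    then have "span (v ` W i) \<subseteq> span (v ` (cyc_interval i k - {i}))" by (intro span_mono image_mono)
    moreover have "k \<noteq> i" "\<not> cyc_le i (\<pi> i) k"
      using k(1) cyc_le_antisym by (auto simp: W_def cyc_interval_def)
    ultimately show ?thesis using decorated_permutation_le_iff by blast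
  qed
  have W: "insert (\<pi> i) (W i) = cyc_interval i (\<pi> i) - {i}" for i
    using decorated_permutation_neq by (auto simp: W_def cyc_interval_def cyc_le_refl)
  have inn: "v i \<in> span (insert (v (\<pi> i)) (v ` W i))" for i
    using decorated_permutation_le_iff[of "\<pi> i" i] decorated_permutation_neq[of i] cyc_le_refl[of i "\<pi> i"]
    by (simp flip: W)
  have False if "\<pi> i = \<pi> i'" "i \<noteq> i'" "cyc_le i i' (\<pi> i)" for i i'
  proof -
    have sub: "insert i' (W i') \<subseteq> W i"
      using that decorated_permutation_neq[of i'] cyc_le_start_trans cyc_le_start_antisym
      by (fastforce simp: W_def cyc_interval_def)
    have "v (\<pi> i) \<in> span (insert (v i') (v ` W i'))"
      using in_span_insert[OF inn notin] that(1) by metis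
    then have "v (\<pi> i) \<in> span (v ` W i)"
      using span_mono[OF image_mono[OF sub, of v]] by auto
    then show False using inn[of i] notin[of i] by (simp add: span_redundant)
  qed
  then show ?thesis using cyc_le_start_total by (metis injI)
qed

text \<open>As the interval is lengthened backwards from \<open>a\<close> to the whole ground set,
  the rank grows by one exactly at those \<open>i\<close> that are not spanned by what follows them
  up to \<open>b\<close>.\<close>

lemma dim_cyc_interval_add_card:
  "dim (v ` cyc_interval a b) + card {i. i \<notin> cyc_interval a b \<and> v i \<notin> span (v ` (cyc_interval i b - {i}))} = DIM('v)"
proof (induction "card (- cyc_interval a b)" arbitrary: a rule: less_induct)
  case less
  show ?case
  proof (cases "cyc_interval a b = UNIV")
    case True
    then show ?thesis using spanning by (metis (no_types, lifting) UNIV_I add_0_right card.empty dim_UNIV dim_span empty_Collect_eq)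
  next
    case False
    then have ne: "- cyc_interval a b \<noteq> {}" by auto
    \<comment> \<open>\<open>p\<close> is the element just before \<open>a\<close>, found as the
      start point nearest to \<open>b\<close> outside the interval.\<close>
    obtain p where p: "p \<notin> cyc_interval a b" "\<And>k. k \<notin> cyc_interval a b \<Longrightarrow> cyc_le k p b"
      using total_order_min[OF finite ne, of "\<lambda>x y. cyc_le y x b"] cyc_le_start_total cyc_le_start_trans
      by (metis ComplD ComplI)
    have pb: "cyc_interval p b = insert p (cyc_interval a b)"
    proof (rule set_eqI)
      fix y
      show "y \<in> cyc_interval p b \<longleftrightarrow> y \<in> insert p (cyc_interval a b)"
      proof (cases "y \<in> cyc_interval a b")
        case True
        then have "cyc_le p y b"
          using p(1) cyc_le_start_total[of a p b] cyc_le_start_trans[of p a b y] by (auto simp: cyc_interval_def)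
        then show ?thesis using True by (simp add: cyc_interval_def)
      next
        case False
        then show ?thesis
          using p(2)[of y] cyc_le_start_antisym[of p y b] cyc_le_first by (auto simp: cyc_interval_def)
      qed
    qed
    then have pb': "cyc_interval p b - {p} = cyc_interval a b" using p(1) by auto
    let ?D = "\<lambda>a. {i. i \<notin> cyc_interval a b \<and> v i \<notin> span (v ` (cyc_interval i b - {i}))}"
    have "- cyc_interval p b \<subset> - cyc_interval a b" using p(1) pb by auto
    then have IH: "dim (v ` cyc_interval p b) + card (?D p) = DIM('v)"
      by (intro less psubset_card_mono) auto
    show ?thesis
    proof (cases "v p \<in> span (v ` cyc_interval a b)")
      case True
      then have "?D a = ?D p" using pb pb' by auto
      then show ?thesis using IH True by (simp add: pb dim_insert)
    next
      case False
      then have "?D a = insert p (?D p)" "p \<notin> ?D p" using pb pb' p(1) by auto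
      then have "card (?D a) = Suc (card (?D p))" by simp
      then show ?thesis using IH False by (simp add: pb dim_insert)
    qed
  qed
qed

text \<open>Since \<open>\<pi>\<close> is a bijection, arrows can be indexed by their end
  \<open>i\<close> instead of their start.\<close>

lemma ccw_eq_card: "ccw \<pi> S = card {i. cyc_interval (\<pi> i) i \<subseteq> S}"
proof -
  have "bij \<pi>" using inj_decorated_permutation by (simp add: bij_def finite_UNIV_inj_surj)
  then have "bij_betw \<pi> {i. cyc_interval (\<pi> i) i \<subseteq> S} {x. ccw_arrow \<pi> x \<subseteq> S}"
    unfolding ccw_arrow_def
    by (intro bij_betwI[where g = "inv \<pi>"]) (auto simp: bij_is_inj bij_is_surj surj_f_inv_f)
  then show ?thesis unfolding ccw_def by (simp add: bij_betw_same_card)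
qed

text \<open>The arrow ending at \<open>i\<close> avoids the interval iff \<open>i\<close> lies
  outside it and \<open>\<pi> i\<close> comes after \<open>b\<close> in the order from
  \<open>i\<close>. By the threshold criterion this is a rank step at \<open>i\<close>.\<close>

lemma dim_cyc_interval_add_ccw:
  "dim (v ` cyc_interval a b) + ccw \<pi> (- cyc_interval a b) = DIM('v)"
proof -
  \<comment> \<open>This makes \<open>b\<close> differ from every \<open>i\<close> outside the
    interval, as the threshold criterion requires.\<close>
  have "b \<in> cyc_interval a b" by (simp add: cyc_interval_def cyc_le_refl)
  then have "{i. cyc_interval (\<pi> i) i \<subseteq> - cyc_interval a b}
    = {i. i \<notin> cyc_interval a b \<and> v i \<notin> span (v ` (cyc_interval i b - {i}))}"
    using decorated_permutation_le_iff[of b] arrow_avoids_interval_iff[OF decorated_permutation_neq, of _ a b]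
    by (intro Collect_cong) metis
  then show ?thesis unfolding ccw_eq_card using dim_cyc_interval_add_card by simp
qed

end

text \<open>At an uncovered point \<open>s\<close>, each arrow in the complement lies in one of two
  smaller pieces, so the arrow count is at most the sum of theirs. By nonnegativity,
  \<open>x\<close> over both pieces sums to at most its sum over the complement.\<close>

lemma ccw_le_sum_of_covered:
  fixes \<pi> :: "'n::{finite,linorder} \<Rightarrow> 'n" and x :: "'n \<Rightarrow> real"
  assumes nonneg: "\<And>i. 0 \<le> x i"
    and covered: "\<And>a b. covered_by_ccw_arrows \<pi> (- cyc_interval a b) \<Longrightarrow>
      ccw \<pi> (- cyc_interval a b) \<le> sum x (- cyc_interval a b)"
  shows "ccw \<pi> (- cyc_interval a b) \<le> sum x (- cyc_interval a b)"
proof (induction "card (- cyc_interval a b)" arbitrary: a b rule: less_induct)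
  case less
  let ?S = "- cyc_interval a b"
  show ?case
  proof (cases "covered_by_ccw_arrows \<pi> ?S")
    case False
    then obtain s where s: "s \<in> ?S" and uncov: "\<And>y. ccw_arrow \<pi> y \<subseteq> ?S \<Longrightarrow> s \<notin> ccw_arrow \<pi> y"
      by (auto simp: covered_by_ccw_arrows_def)
    let ?S1 = "- cyc_interval s b" and ?S2 = "- cyc_interval a s"
    have split: "cyc_interval s b \<union> cyc_interval a s = UNIV"
      "cyc_interval s b \<inter> cyc_interval a s = insert s (cyc_interval a b)"
      using cyc_interval_split[of s a b] s by simp_all
    have sub: "?S1 \<union> ?S2 \<subseteq> ?S" "?S1 \<inter> ?S2 = {}" "s \<notin> ?S1" "s \<notin> ?S2"
      using split by blast+
    then have "?S1 \<subset> ?S" "?S2 \<subset> ?S" using s by blast+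
    then have IH: "ccw \<pi> ?S1 \<le> sum x ?S1" "ccw \<pi> ?S2 \<le> sum x ?S2"
      using less by (simp_all add: psubset_card_mono)
    have "{y. ccw_arrow \<pi> y \<subseteq> ?S} \<subseteq> {y. ccw_arrow \<pi> y \<subseteq> ?S1} \<union> {y. ccw_arrow \<pi> y \<subseteq> ?S2}"
      using uncov arrow_avoiding_point unfolding ccw_arrow_def by blast
    then have "ccw \<pi> ?S \<le> card ({y. ccw_arrow \<pi> y \<subseteq> ?S1} \<union> {y. ccw_arrow \<pi> y \<subseteq> ?S2})"
      unfolding ccw_def by (intro card_mono) auto
    also have "\<dots> \<le> ccw \<pi> ?S1 + ccw \<pi> ?S2" unfolding ccw_def by (rule card_Un_le)
    finally have "ccw \<pi> ?S \<le> sum x ?S1 + sum x ?S2" using IH by simp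
    also have "\<dots> = sum x (?S1 \<union> ?S2)" using sub by (intro sum.union_disjoint[symmetric]) auto
    also have "\<dots> \<le> sum x ?S" using sub nonneg by (intro sum_mono2) auto
    finally show ?thesis .
  qed (rule covered)
qed

section \<open>Valid inequalities on the polytope, vectors of a positroid, and the final
  description\<close>

lemma linear_le_on_matroid_polytope:
  fixes f :: "real ^ 'n::finite \<Rightarrow> real"
  assumes "x \<in> matroid_polytope M" "linear f" "\<And>B. B \<in> M \<Longrightarrow> f (\<Sum>i\<in>B. axis i 1) \<le> c"
  shows "f x \<le> c"
proof -
  have "convex (f -` {..c})" by (intro convex_linear_vimage assms convex_real_interval)
  then have "matroid_polytope M \<subseteq> f -` {..c}"
    unfolding matroid_polytope_def using assms(3) by (intro hull_minimal) auto
  then show ?thesis using assms(1) by auto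
qed

text \<open>Transposition preserves determinants, so the columns of the matrix can serve as the rows
  in \<open>column_det\<close>.\<close>

lemma positroid_vectors:
  fixes M :: "'n::{finite,linorder} set set"
  assumes "positroid TYPE('d::{finite,linorder}) M"
  obtains v :: "'n \<Rightarrow> real ^ 'd::{finite,linorder}" where "\<And>f :: 'd \<Rightarrow> 'n. strict_mono f \<Longrightarrow> 0 \<le> column_det v f"
    "M = {B. basis_set v B}"
proof -
  obtain A :: "real ^ 'n::{finite,linorder} ^ 'd::{finite,linorder}" where A: "\<And>f. strict_mono f \<Longrightarrow> max_minor A f \<ge> 0"
    "M = {range f | f. strict_mono f \<and> max_minor A f \<noteq> 0}"
    using assms unfolding positroid_def by blast
  define v where "v = (\<lambda>i. column i A)"
  have minor: "max_minor A f = column_det v f" for f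
  proof -
    have "(\<chi> j. v (f j)) = transpose (\<chi> i j. A $ i $ f j)"
      by (simp add: vec_eq_iff v_def column_def transpose_def)
    then show ?thesis by (simp add: max_minor_def column_det_def det_transpose)
  qed
  have "basis_set v B \<longleftrightarrow> B \<in> M" for B
  proof
    assume B: "basis_set v B"
    then have "card B = CARD('d)" using card_basis_set by fastforce
    then obtain f :: "'d \<Rightarrow> 'n" where "strict_mono f" "range f = B" by (rule ex_strict_mono_range)
    then show "B \<in> M"
      using B column_det_nonzero_iff[of f v] strict_mono_imp_inj_on unfolding A(2) minor by blast
  next
    assume "B \<in> M"
    then show "basis_set v B"
      using column_det_nonzero_iff[of _ v] strict_mono_imp_inj_on unfolding A(2) minor by blast
  qed
  then show thesis using that[of v] A(1) minor by auto
qed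

theorem theorem5p1:
  fixes M :: "'n::{finite,linorder} set set" and \<pi> :: "'n \<Rightarrow> 'n"
  assumes "positroid TYPE('d::{finite,linorder}) M"
    and "\<And>i. \<not> is_loop M i"
    and "\<And>i. \<not> is_coloop M i"
    and "\<pi> = decorated_permutation M"
  shows "matroid_polytope M =
    {x.
       (\<forall>i. 0 \<le> x $ i) \<and>
       (\<Sum>i\<in>UNIV. x $ i) = real CARD('d) \<and>
       (\<forall>E. (\<exists>a b. E = cyc_interval a b) \<and> covered_by_ccw_arrows \<pi> (- E) \<longrightarrow>
          (\<Sum>l\<in>E. x $ l) \<le> real CARD('d) - real (ccw \<pi> (- E)))}"
proof -
  obtain v :: "'n \<Rightarrow> real ^ 'd::{finite,linorder}" where pos: "\<And>f :: 'd \<Rightarrow> 'n. strict_mono f \<Longrightarrow> 0 \<le> column_det v f"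
    and M: "M = {B. basis_set v B}"
    using positroid_vectors[OF assms(1)] by blast
  \<comment> \<open>Without any basis, every element would vacuously be a coloop.\<close>
  obtain B0 where B0: "B0 \<in> M" using assms(3) by (auto simp: is_coloop_def)
  have spanning: "span (range v) = UNIV"
    using B0 span_mono[OF image_mono[OF subset_UNIV, of v B0]] by (auto simp: M basis_set_def)
  have nonzero: "v i \<noteq> 0" for i
  proof -
    obtain B where "i \<in> B" "lin_indep v B" using assms(2)[of i] by (auto simp: is_loop_def M basis_set_def)
    then show ?thesis using dependent_zero[of "v ` B"] by (metis image_eqI lin_indep_def)
  qed
  have nocoloop: "v i \<in> span (v ` (- {i}))" for i
  proof -
    obtain B where B: "i \<notin> B" "span (v ` B) = UNIV"
      using assms(3)[of i] by (auto simp: is_coloop_def M basis_set_def)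
    then have "span (v ` B) \<subseteq> span (v ` (- {i}))" by (intro span_mono image_mono) auto
    then show ?thesis using B by auto
  qed
  have rank: "dim (v ` cyc_interval a b) + ccw \<pi> (- cyc_interval a b) = CARD('d)" for a b
    using dim_cyc_interval_add_ccw[OF M spanning nonzero nocoloop assms(4)] by simp
  show ?thesis (is "_ = ?P")
  proof
    show "matroid_polytope M \<subseteq> ?P"
    proof
      fix x assume x: "x \<in> matroid_polytope M"
      have lin: "linear (\<lambda>x :: real ^ 'n::{finite,linorder}. \<Sum>l\<in>E. c * x $ l)" for E :: "'n set" and c :: real
        by (rule linearI) (simp_all add: sum.distrib algebra_simps sum_distrib_left)
      \<comment> \<open>The factor \<open>c\<close> will be 1 or -1, so that one bound on vertices
        yields both upper and lower estimates.\<close>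
      have le: "(\<Sum>l\<in>E. c * x $ l) \<le> b" if "\<And>B. basis_set v B \<Longrightarrow> c * card (B \<inter> E) \<le> b"
        for E and c b :: real
      proof (rule linear_le_on_matroid_polytope[OF x lin])
        fix B assume "B \<in> M"
        then show "(\<Sum>l\<in>E. c * (\<Sum>i\<in>B. axis i 1) $ l) \<le> b"
          using that[of B] unfolding sum_axis_nth sum_distrib_left[symmetric] by (simp add: M Int_commute)
      qed
      have "0 \<le> x $ i" for i using le[of "-1" "{i}" 0] by simp
      moreover have "(\<Sum>i\<in>UNIV. x $ i) = CARD('d)"
        using le[of "-1" UNIV "- CARD('d)"] le[of 1 UNIV "CARD('d)"] card_basis_set[of v]
        by (simp add: sum_negf)
      moreover have "(\<Sum>l\<in>cyc_interval a b. x $ l) \<le> CARD('d) - real (ccw \<pi> (- cyc_interval a b))" for a b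
      proof -
        have "card (B \<inter> cyc_interval a b) \<le> dim (v ` cyc_interval a b)" if "basis_set v B" for B
          using that lin_indep_subset[of v B "B \<inter> cyc_interval a b"] dim_subset[OF image_mono, of "B \<inter> cyc_interval a b" "cyc_interval a b" v]
          by (simp add: basis_set_def card_lin_indep)
        then show ?thesis using le[of 1 "cyc_interval a b" "dim (v ` cyc_interval a b)"] rank[of a b] by simp
      qed
      ultimately show "x \<in> ?P" by auto
    qed
    show "?P \<subseteq> matroid_polytope M"
    proof
      fix x assume x: "x \<in> ?P"
      have compl: "(\<Sum>i\<in>- E. x $ i) = CARD('d) - (\<Sum>i\<in>E. x $ i)" for E
        using x sum.union_disjoint[of E "- E" "\<lambda>i. x $ i"] by (simp add: Compl_partition)
      \<comment> \<open>Passing to complements extends the inequalities from covered complements to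
        all cyclic intervals, where \<open>rank\<close> turns them into rank bounds.\<close>
      have "(\<Sum>i\<in>- cyc_interval a b. x $ i) \<ge> ccw \<pi> (- cyc_interval a b)" for a b
      proof (rule ccw_le_sum_of_covered)
        show "0 \<le> x $ i" for i using x by blast
        fix a b assume "covered_by_ccw_arrows \<pi> (- cyc_interval a b)"
        then have "(\<Sum>i\<in>cyc_interval a b. x $ i) \<le> CARD('d) - real (ccw \<pi> (- cyc_interval a b))"
          using x by blast
        then show "ccw \<pi> (- cyc_interval a b) \<le> (\<Sum>i\<in>- cyc_interval a b. x $ i)"
          unfolding compl by simp
      qed
      then have intervals: "(\<Sum>i\<in>cyc_interval a b. x $ i) \<le> dim (v ` cyc_interval a b)" for a b
        using rank[of a b] compl[of "cyc_interval a b"] by (smt (verit) of_nat_add)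
      show "x \<in> matroid_polytope M"
        using x by (intro matroid_polytopeI[OF M spanning] rank_bound_of_interval_bounds[OF pos spanning _ intervals]) auto
    qed
  qed
qed

end
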